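(* Let $A,B,\Omega\in\mathbb{R}^{n\times n}$ and $c\in\mathbb{R}^n$. Let $A+\Omega$ be nonsingular and $$\|(A+\Omega)^{-1}\Omega\|+\|(A+\Omega)^{-1}B\|<1.$$ Then the system $Ax-B|x|-c=0$ has a unique solution $x^*\in\mathbb{R}^n$, and for every initial vector $x^0\in\mathbb{R}^n$ the modified Newton-type iteration $$x^{k+1}=(A+\Omega)^{-1}\left(\Omega x^k+B|x^k|+c\right),\qquad k=0,1,2,\dots,$$ converges to $x^*$.
   Context: For $x\in\mathbb{R}^n$, $|x|=(|x_1|,\dots,|x_n|)^\top$ is the componentwise absolute value. $\|\cdot\|$ denotes the Euclidean norm of vectors and the induced $2$-norm (spectral norm) of matrices. *)

theory Defs
  imports "HOL-Analysis.Analysis"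
begin

text \<open>
  The library norm on \<open>real ^ 'n ^ 'n\<close> is the Frobenius norm, so the norm induced by the
  Euclidean vector norm is the operator norm of the associated linear map.
\<close>

definition spectral_norm :: "real ^ 'n ^ 'm \<Rightarrow> real" where
  "spectral_norm M = onorm ((*v) M)"

text \<open>On \<open>real ^ 'n\<close>, the library's \<open>\<bar>x\<bar>\<close> is the componentwise absolute value (\<open>abs_vec_def\<close>).\<close>

primrec newton_iter ::
  "real ^ 'n ^ 'n \<Rightarrow> real ^ 'n ^ 'n \<Rightarrow> real ^ 'n ^ 'n \<Rightarrow> real ^ 'n \<Rightarrow> real ^ 'n \<Rightarrow> nat \<Rightarrow> real ^ 'n"
where
  "newton_iter A B \<Omega> c x0 0 = x0"
| "newton_iter A B \<Omega> c x0 (Suc k) =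
     matrix_inv (A + \<Omega>) *v
       (\<Omega> *v newton_iter A B \<Omega> c x0 k + B *v \<bar>newton_iter A B \<Omega> c x0 k\<bar> + c)"

end

theory Submission
  imports Defs
begin

text \<open>
  The iteration map \<open>T x = (A + \<Omega>)\<^sup>-\<^sup>1 (\<Omega> x + B |x| + c)\<close> has the solutions of the system as its
  fixed points. Since \<open>x \<mapsto> |x|\<close> is nonexpansive in the Euclidean norm, \<open>T\<close> is Lipschitz with the
  constant that is assumed to be less than 1, so Banach's fixed point theorem applies and the
  errors of the iterates decay geometrically.
\<close>

text \<open>The reverse triangle inequality holds in each component, and the Euclidean norm is
  monotone in the absolute values of the components.\<close>

lemma norm_abs_diff_le_vec: "norm (\<bar>x\<bar> - \<bar>y\<bar>) \<le> norm (x - y)" for x y :: "real ^ 'n"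
  by (rule norm_le_componentwise_cart) (simp add: abs_vec_def)

lemma norm_matrix_vector_mult_le: "norm (M *v x) \<le> spectral_norm M * norm x"
  unfolding spectral_norm_def
  by (rule onorm) (rule matrix_vector_mul_bounded_linear)

lemma spectral_norm_nonneg: "0 \<le> spectral_norm M"
  unfolding spectral_norm_def
  by (rule onorm_pos_le) (rule matrix_vector_mul_bounded_linear)

text \<open>Each step shrinks the distance to the fixed point \<open>p\<close> by the factor
  \<open>q\<close>, so the error after \<open>k\<close> steps is at most \<open>q ^ k\<close> times
  the initial one.\<close>

lemma contraction_iterates_tendsto:
  fixes T :: "'a::real_normed_vector \<Rightarrow> 'a"
  assumes "0 \<le> q" "q < 1"
    and lip: "\<And>x y. norm (T x - T y) \<le> q * norm (x - y)"
    and fp: "T p = p"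
    and step: "\<And>k. u (Suc k) = T (u k)"
  shows "u \<longlonglongrightarrow> p"
proof -
  have bound: "norm (u k - p) \<le> q ^ k * norm (u 0 - p)" for k
  proof (induction k)
    case (Suc k)
    have "norm (u (Suc k) - p) \<le> q * norm (u k - p)"
      using lip[of "u k" p] by (simp add: step fp)
    also have "\<dots> \<le> q * (q ^ k * norm (u 0 - p))"
      using Suc \<open>0 \<le> q\<close> by (rule mult_left_mono)
    finally show ?case by (simp add: mult.assoc)
  qed simp
  have "(\<lambda>k. q ^ k * norm (u 0 - p)) \<longlonglongrightarrow> 0"
    using assms(1,2) by (intro tendsto_mult_left_zero LIMSEQ_power_zero) simp
  then have "(\<lambda>k. u k - p) \<longlonglongrightarrow> 0"
    by (rule Lim_null_comparison[rotated]) (simp add: bound)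
  then show ?thesis by (simp add: LIM_zero_iff)
qed

theorem corollary3p2:
  fixes A B \<Omega> :: "real ^ 'n ^ 'n" and c :: "real ^ 'n"
  assumes "invertible (A + \<Omega>)"
    and "spectral_norm (matrix_inv (A + \<Omega>) ** \<Omega>) + spectral_norm (matrix_inv (A + \<Omega>) ** B) < 1"
  shows "(\<exists>!x. A *v x - B *v \<bar>x\<bar> - c = 0) \<and>
    (\<forall>x. A *v x - B *v \<bar>x\<bar> - c = 0 \<longrightarrow>
      (\<forall>x0. newton_iter A B \<Omega> c x0 \<longlonglongrightarrow> x))"
proof -
  let ?N = "matrix_inv (A + \<Omega>)"
  define q where "q = spectral_norm (?N ** \<Omega>) + spectral_norm (?N ** B)"
  define T where "T x = ?N *v (\<Omega> *v x + B *v \<bar>x\<bar> + c)" for x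
  have q: "0 \<le> q" "q < 1"
    using assms(2) by (simp_all add: q_def spectral_norm_nonneg)
  have lip: "norm (T x - T y) \<le> q * norm (x - y)" for x y
  proof -
    \<comment> \<open>The constant \<open>c\<close> cancels, and the linear and absolute-value parts
      separate into the two matrices whose norms add up to \<open>q\<close>.\<close>
    have "T x - T y = (?N ** \<Omega>) *v (x - y) + (?N ** B) *v (\<bar>x\<bar> - \<bar>y\<bar>)"
      by (simp add: T_def matrix_vector_mul_assoc[symmetric] matrix_vector_right_distrib
          matrix_vector_mult_diff_distrib)
    also have "norm \<dots> \<le> spectral_norm (?N ** \<Omega>) * norm (x - y)
        + spectral_norm (?N ** B) * norm (\<bar>x\<bar> - \<bar>y\<bar>)"
      by (intro norm_triangle_mono norm_matrix_vector_mult_le)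
    also have "\<dots> \<le> q * norm (x - y)"
      by (simp add: q_def distrib_right mult_left_mono norm_abs_diff_le_vec spectral_norm_nonneg)
    finally show ?thesis .
  qed
  \<comment> \<open>\<open>matrix_inv\<close> is a Hilbert choice; invertibility ensures that the
    chosen matrix is a two-sided inverse.\<close>
  have inv: "?N ** (A + \<Omega>) = mat 1" "(A + \<Omega>) ** ?N = mat 1"
    using someI_ex[OF assms(1)[unfolded invertible_def]] by (simp_all add: matrix_inv_def)
  have fixed_iff: "A *v x - B *v \<bar>x\<bar> - c = 0 \<longleftrightarrow> T x = x" for x
  proof -
    \<comment> \<open>Multiplying by \<open>A + \<Omega>\<close> gives one direction, multiplying by
      its inverse the other; afterwards \<open>\<Omega> *v x\<close> cancels on both sides.\<close>
    have "T x = x \<longleftrightarrow> (A + \<Omega>) *v x = \<Omega> *v x + B *v \<bar>x\<bar> + c"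
      unfolding T_def by (metis inv matrix_vector_mul_assoc matrix_vector_mul_lid)
    then show ?thesis
      by (auto simp: matrix_vector_mult_add_rdistrib algebra_simps)
  qed
  have "\<exists>!x. T x = x"
    using q by (rule banach_fix_type) (simp add: dist_norm lip)
  then have "\<exists>!x. A *v x - B *v \<bar>x\<bar> - c = 0"
    by (simp only: fixed_iff)
  moreover have "newton_iter A B \<Omega> c x0 \<longlonglongrightarrow> x" if "T x = x" for x x0
    using q lip that by (rule contraction_iterates_tendsto) (simp add: T_def)
  ultimately show ?thesis
    unfolding fixed_iff by blast
qed

end
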